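(* For any fixed $m\in[0,1]$ and $\mu\in[0,1]$, the worst-case instance $P^*$, i.e. the distribution attaining $\inf_{P\in\mathcal{P}(\mu)}G(c,m,P)$, is $P^*=\mathrm{Bern}(\mu)$. Furthermore, for any $m\in[0,1]$, any distribution $P$ over $[0,1]$ with mean $\mu$, and $c\ge 1/4$, the worst-case growth rate is nonnegative, i.e. $$\inf_{P\in\mathcal{P}(\mu)}G(c,m,P)\ge 0 .$$ In particular, (1) $G(c,m,P)$ is equal to $0$ only if $\mu=m$, and (2) $G(c,m,P)$ monotonically increases with respect to $|\mu-m|$.
   Context: For $\mu\in[0,1]$, $\mathcal{P}(\mu)$ is the set of all probability distributions on $[0,1]$ with mean $\mu$, and $\mathrm{Bern}(\mu)$ is the Bernoulli distribution with mean $\mu$. The constant $c$ satisfies $c\ge 1/4$. For $m\in[0,1]$ and $P\in\mathcal{P}(\mu)$, the asymptotic growth rate is $$G(c,m,P)=\mathbb{E}_{X\sim P}\left[\log\left(1+\frac{(\mu-m)(X-m)}{c}\right)\right].$$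
   Formalization: Bern(μ) is shown to be the only minimizer just for μ≠m (at μ=m every P gives 0); monotonicity in |μ-m| is stated on each side of μ=m separately (fixed P with m varying; fixed m with μ varying in the infimum), as comparing across sides is false. *)

theory Defs
  imports "HOL-Probability.Probability"
begin

definition mean :: "real measure \<Rightarrow> real" where
  "mean P = (LINT x|P. x)"

definition dists_with_mean :: "real \<Rightarrow> real measure set" where
  "dists_with_mean \<mu> = {P. real_distribution P \<and> (AE x in P. x \<in> {0..1}) \<and> mean P = \<mu>}"

definition bern :: "real \<Rightarrow> real measure" where
  "bern \<mu> = distr (measure_pmf (bernoulli_pmf \<mu>)) borel of_bool"

text \<open>
  The growth rate is a genuine real expectation: for \<open>c \<ge> 1/4\<close> the argument of the logarithm
  is positive almost surely and the logarithm is integrable (lemmas \<open>growth_arg_pos\<close> and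
  \<open>growth_integrable\<close> below), so neither the value of \<^const>\<open>ln\<close> outside the positive reals nor
  the value of the Bochner integral at non-integrable functions is ever used.
\<close>

definition growth :: "real \<Rightarrow> real \<Rightarrow> real measure \<Rightarrow> real" where
  "growth c m P = (LINT x|P. ln (1 + (mean P - m) * (x - m) / c))"

text \<open>The infimum is taken in the complete lattice of extended reals, so that it is meaningful
  without a separate argument for boundedness.\<close>

definition worst_growth :: "real \<Rightarrow> real \<Rightarrow> real \<Rightarrow> ereal" where
  "worst_growth c m \<mu> = (INF P\<in>dists_with_mean \<mu>. ereal (growth c m P))"

lemma mean_bern: "0 \<le> \<mu> \<Longrightarrow> \<mu> \<le> 1 \<Longrightarrow> mean (bern \<mu>) = \<mu>"
  unfolding mean_def bern_def
  by (subst integral_distr) auto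

lemma bern_in_dists_with_mean:
  assumes "0 \<le> \<mu>" "\<mu> \<le> 1"
  shows "bern \<mu> \<in> dists_with_mean \<mu>"
proof -
  interpret prob_space "bern \<mu>"
    unfolding bern_def by (rule measure_pmf.prob_space_distr) auto
  have "real_distribution (bern \<mu>)"
    by unfold_locales (auto simp: bern_def)
  moreover have "AE x in bern \<mu>. x \<in> {0..1}"
    unfolding bern_def by (subst AE_distr_iff) auto
  ultimately show ?thesis
    using mean_bern[OF assms] by (auto simp: dists_with_mean_def)
qed

lemma dists_with_mean_integrable:
  assumes "P \<in> dists_with_mean \<mu>"
  shows "integrable P (\<lambda>x. x)"
proof -
  interpret real_distribution P
    using assms by (simp add: dists_with_mean_def)
  show ?thesis
    using assms by (intro integrable_const_bound[where B = 1]) (auto simp: dists_with_mean_def)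
qed

lemma growth_arg_ge:
  fixes c m \<mu> x :: real
  assumes "c \<ge> 1 / 4" "m \<in> {0..1}" "\<mu> \<in> {0..1}" "x \<in> {0..1}"
  shows "min \<mu> (1 - \<mu>) \<le> 1 + (\<mu> - m) * (x - m) / c"
proof -
  have q: "m * (1 - m) \<le> 1 / 4"
    using zero_le_power2[of "m - 1/2"] by (simp add: power2_eq_square algebra_simps)
  have c: "c > 0" using assms by simp
  show ?thesis
  proof (cases "m \<le> \<mu>")
    case True
    have "(\<mu> - m) * m \<le> \<mu> * (m * (1 - m))"
    proof -
      have "0 \<le> m * m * (1 - \<mu>)" using assms by simp
      then show ?thesis by (simp add: algebra_simps)
    qed
    also have "\<dots> \<le> \<mu> * c"
      using assms q by (intro mult_left_mono) auto
    finally have "- (\<mu> * c) \<le> (\<mu> - m) * (0 - m)" by simp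
    also have "\<dots> \<le> (\<mu> - m) * (x - m)"
      using True assms by (intro mult_left_mono) auto
    finally have "- \<mu> \<le> (\<mu> - m) * (x - m) / c" using c by (simp add: field_simps)
    then show ?thesis by simp
  next
    case False
    have "(m - \<mu>) * (1 - m) \<le> (1 - \<mu>) * (m * (1 - m))"
    proof -
      have "0 \<le> (1 - m) * (1 - m) * \<mu>" using assms by simp
      then show ?thesis by (simp add: algebra_simps)
    qed
    also have "\<dots> \<le> (1 - \<mu>) * c"
      using assms q by (intro mult_left_mono) auto
    finally have "- ((1 - \<mu>) * c) \<le> (\<mu> - m) * (1 - m)" by (simp add: algebra_simps)
    also have "\<dots> \<le> (\<mu> - m) * (x - m)"
      using False assms by (intro mult_left_mono_neg) auto
    finally have "- (1 - \<mu>) \<le> (\<mu> - m) * (x - m) / c" using c by (simp add: field_simps)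
    then show ?thesis by simp
  qed
qed

lemma dists_with_mean_degenerate:
  assumes P: "P \<in> dists_with_mean \<mu>" and "\<mu> = 0 \<or> \<mu> = 1"
  shows "AE x in P. x = \<mu>"
proof -
  interpret real_distribution P
    using P by (simp add: dists_with_mean_def)
  have int: "integrable P (\<lambda>x. x)" by (rule dists_with_mean_integrable[OF P])
  have AE: "AE x in P. x \<in> {0..1}" and mean: "(LINT x|P. x) = \<mu>"
    using P by (auto simp: dists_with_mean_def mean_def)
  show ?thesis
    using assms(2)
  proof
    assume "\<mu> = 0"
    then show ?thesis
      using integral_nonneg_eq_0_iff_AE[OF int] AE mean by auto
  next
    assume "\<mu> = 1"
    moreover have "(LINT x|P. 1 - x) = 1 - \<mu>"
      using int mean prob_space by simp
    moreover have "integrable P (\<lambda>x. 1 - x)" using int by simp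
    moreover have "AE x in P. 0 \<le> 1 - x" using AE by auto
    ultimately have "AE x in P. 1 - x = 0"
      using integral_nonneg_eq_0_iff_AE[of P "\<lambda>x. 1 - x"] by simp
    then show ?thesis using \<open>\<mu> = 1\<close> by auto
  qed
qed

lemma growth_arg_bound:
  assumes "c \<ge> 1 / 4" "m \<in> {0..1}" "\<mu> \<in> {0..1}" "P \<in> dists_with_mean \<mu>"
  obtains \<delta> where "\<delta> > 0" "AE x in P. \<delta> \<le> 1 + (mean P - m) * (x - m) / c"
proof (cases "\<mu> = 0 \<or> \<mu> = 1")
  case True
  have "1 \<le> 1 + (\<mu> - m) * (\<mu> - m) / c" using assms(1) by simp
  then have "AE x in P. 1 \<le> 1 + (\<mu> - m) * (x - m) / c"
    using dists_with_mean_degenerate[OF assms(4) True] by auto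
  then show ?thesis
    using that[of 1] assms(4) by (simp add: dists_with_mean_def)
next
  case False
  have "AE x in P. x \<in> {0..1}" "mean P = \<mu>"
    using assms(4) by (auto simp: dists_with_mean_def)
  then have "AE x in P. min \<mu> (1 - \<mu>) \<le> 1 + (mean P - m) * (x - m) / c"
    using growth_arg_ge[OF assms(1-3)] by auto
  then show ?thesis
    using that[of "min \<mu> (1 - \<mu>)"] False assms(3) by auto
qed

lemma growth_arg_pos:
  assumes "c \<ge> 1 / 4" "m \<in> {0..1}" "\<mu> \<in> {0..1}" "P \<in> dists_with_mean \<mu>"
  shows "AE x in P. 0 < 1 + (mean P - m) * (x - m) / c"
proof -
  obtain \<delta> where "\<delta> > 0" "AE x in P. \<delta> \<le> 1 + (mean P - m) * (x - m) / c"
    using growth_arg_bound[OF assms] .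
  then show ?thesis by auto
qed

lemma growth_integrable:
  assumes "c \<ge> 1 / 4" "m \<in> {0..1}" "\<mu> \<in> {0..1}" "P \<in> dists_with_mean \<mu>"
  shows "integrable P (\<lambda>x. ln (1 + (mean P - m) * (x - m) / c))"
proof -
  interpret real_distribution P
    using assms by (simp add: dists_with_mean_def)
  obtain \<delta> where \<delta>: "\<delta> > 0" "AE x in P. \<delta> \<le> 1 + (mean P - m) * (x - m) / c"
    using growth_arg_bound[OF assms] .
  have \<mu>: "mean P = \<mu>" and AE: "AE x in P. x \<in> {0..1}"
    using assms(4) by (auto simp: dists_with_mean_def)
  have bound: "\<bar>ln (1 + (\<mu> - m) * (x - m) / c)\<bar> \<le> \<bar>ln \<delta>\<bar> + ln 5"
    if x: "x \<in> {0..1}" and d: "\<delta> \<le> 1 + (\<mu> - m) * (x - m) / c" for x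
  proof -
    have "\<bar>(\<mu> - m) * (x - m)\<bar> \<le> 1 * 1"
      unfolding abs_mult using x assms by (intro mult_mono) auto
    then have "(\<mu> - m) * (x - m) / c \<le> 4"
      using assms(1) by (simp add: pos_divide_le_eq)
    then have u: "1 + (\<mu> - m) * (x - m) / c \<le> 5" by simp
    have "ln (1 + (\<mu> - m) * (x - m) / c) \<le> ln 5"
      by (rule ln_mono) (use u d \<delta>(1) in linarith)+
    moreover have "ln \<delta> \<le> ln (1 + (\<mu> - m) * (x - m) / c)"
      by (rule ln_mono) (use d \<delta>(1) in linarith)+
    moreover have "0 \<le> ln (5 :: real)" by simp
    ultimately show ?thesis by linarith
  qed
  have "AE x in P. norm (ln (1 + (mean P - m) * (x - m) / c)) \<le> \<bar>ln \<delta>\<bar> + ln 5"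
    using AE \<delta>(2) unfolding \<mu> by eventually_elim (use bound in auto)
  then show ?thesis
    by (rule integrable_const_bound) measurable
qed

end

theory Submission
  imports Defs
begin

text \<open>
  For \<open>0 < \<mu> < 1\<close> the integrand is concave in \<open>x\<close>, so replacing it by its chord over
  \<open>[0, 1]\<close> lowers the expectation to its value at \<open>Bern(\<mu>)\<close>; for \<open>\<mu> \<noteq> m\<close> the concavity is strict, and
  equality forces \<open>x \<in> {0, 1}\<close> almost surely.

  Both monotonicity claims avoid derivatives through \<open>ln v - ln u \<ge> 1 - u / v\<close>. Write
  \<open>L(x) = 1 + (\<mu> - m) (x - m) / c\<close>. After this estimate both claims reduce to \<open>E[1 / L(X)] \<le> 1\<close>, and
  by convexity of the reciprocal it suffices to check this for the Bernoulli distribution, where it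
  says \<open>m (1 - m) \<le> c\<close>. Strictness comes from the logarithmic estimate, and positivity of the growth
  rate is the special case of comparing with \<open>m = \<mu>\<close>, where the growth rate vanishes.
\<close>

section \<open>Pointwise integrand and its Bernoulli expectation\<close>

definition capital :: "real \<Rightarrow> real \<Rightarrow> real \<Rightarrow> real \<Rightarrow> real" where
  "capital c m \<mu> x = 1 + (\<mu> - m) * (x - m) / c"

text \<open>The growth rate of \<open>bern \<mu>\<close> as a finite sum. For \<open>\<mu>\<close>
  in {0, 1} the logarithm at the other endpoint may have argument 0 (\<open>c = 1/4\<close>,
  \<open>m = 1/2\<close>), but its weight is then 0.\<close>

definition bern_growth :: "real \<Rightarrow> real \<Rightarrow> real \<Rightarrow> real" where
  "bern_growth c m \<mu> = (1 - \<mu>) * ln (capital c m \<mu> 0) + \<mu> * ln (capital c m \<mu> 1)"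

section \<open>Inequalities for the logarithm and the reciprocal\<close>

lemma mult_one_minus_le_quarter: "m * (1 - m) \<le> 1 / 4" for m :: real
  using zero_le_power2[of "m - 1/2"] by (simp add: power2_eq_square algebra_simps)

lemma ln_diff_ge:
  fixes u v :: real
  assumes "0 < u" "0 < v"
  shows "1 - u / v \<le> ln v - ln u"
  using ln_le_minus_one[of "u / v"] assms by (simp add: ln_div)

lemma ln_diff_eqD:
  fixes u v :: real
  assumes "0 < u" "0 < v" "ln v - ln u = 1 - u / v"
  shows "u = v"
  using ln_eq_minus_one[of "u / v"] assms by (simp add: ln_div)

text \<open>Comparing both logarithms with the one at the common point \<open>?u\<close> and
  averaging cancels the linear terms. Equality in the average makes each comparison of positive
  weight an equality, whence \<open>a = ?u = b\<close>.\<close>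

lemma ln_chord_le:
  fixes a b x :: real
  assumes "0 < a" "0 < b" "0 \<le> x" "x \<le> 1"
  shows "(1 - x) * ln a + x * ln b \<le> ln ((1 - x) * a + x * b)" (is "_ \<le> ln ?u")
    and "a \<noteq> b \<Longrightarrow> (1 - x) * ln a + x * ln b = ln ((1 - x) * a + x * b) \<Longrightarrow> x = 0 \<or> x = 1"
proof -
  have u: "0 < ?u"
    using assms by (cases "x = 0") (auto intro!: add_nonneg_pos)
  have sum0: "(1 - x) * (1 - a / ?u) + x * (1 - b / ?u) = 0"
  proof -
    have "(1 - x) * (1 - a / ?u) + x * (1 - b / ?u) = 1 - ?u / ?u"
      by (simp only: add_divide_distrib times_divide_eq_right[symmetric] right_diff_distrib) simp
    then show ?thesis using u by simp
  qed
  have a: "(1 - x) * (1 - a / ?u) \<le> (1 - x) * (ln ?u - ln a)"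
    by (rule mult_left_mono[OF ln_diff_ge]) (use assms u in auto)
  have b: "x * (1 - b / ?u) \<le> x * (ln ?u - ln b)"
    by (rule mult_left_mono[OF ln_diff_ge]) (use assms u in auto)
  have diff: "(1 - x) * (ln ?u - ln a) + x * (ln ?u - ln b)
      = ln ?u - ((1 - x) * ln a + x * ln b)"
    by (simp only: algebra_simps)
  show "(1 - x) * ln a + x * ln b \<le> ln ?u"
    using a b sum0 diff by linarith
  assume ne: "a \<noteq> b" and eq: "(1 - x) * ln a + x * ln b = ln ?u"
  show "x = 0 \<or> x = 1"
  proof (rule ccontr)
    assume x: "\<not> (x = 0 \<or> x = 1)"
    have "(1 - x) * (ln ?u - ln a) = (1 - x) * (1 - a / ?u)"
      and "x * (ln ?u - ln b) = x * (1 - b / ?u)"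
      using a b sum0 diff eq by linarith+
    then have "ln ?u - ln a = 1 - a / ?u" "ln ?u - ln b = 1 - b / ?u"
      using x by auto
    then have "a = ?u" "b = ?u"
      using ln_diff_eqD u assms by blast+
    then show False using ne by metis
  qed
qed

text \<open>Multiplied by the weighted mean of \<open>a\<close> and \<open>b\<close>, the right-hand
  side exceeds 1 by a nonnegative multiple of \<open>(a - b)\<^sup>2\<close>.\<close>

lemma inverse_chord_ge:
  fixes a b x :: real
  assumes "0 < a" "0 < b" "0 \<le> x" "x \<le> 1"
  shows "1 / ((1 - x) * a + x * b) \<le> (1 - x) / a + x / b"
proof -
  have u: "0 < (1 - x) * a + x * b"
    using assms by (cases "x = 0") (auto intro!: add_nonneg_pos)
  have "((1 - x) / a + x / b) * ((1 - x) * a + x * b) = 1 + x * (1 - x) * (a - b)\<^sup>2 / (a * b)"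
    using assms by (simp add: field_simps power2_eq_square)
  also have "\<dots> \<ge> 1" using assms by simp
  finally show ?thesis using u by (simp add: pos_divide_le_eq)
qed

section \<open>Affine form, symmetry and bounds of the capital\<close>

lemma capital_chord: "capital c m \<mu> x = (1 - x) * capital c m \<mu> 0 + x * capital c m \<mu> 1"
  by (cases "c = 0") (simp_all add: capital_def field_simps)

text \<open>Both factors \<open>\<mu> - m\<close> and \<open>x - m\<close> change sign. The
  reflection swaps the endpoints and the cases \<open>m \<le> \<mu>\<close> and
  \<open>\<mu> \<le> m\<close>.\<close>

lemma capital_reflect: "capital c (1 - m) (1 - \<mu>) (1 - x) = capital c m \<mu> x"
  by (simp add: capital_def algebra_simps)

text \<open>Sharpens \<open>growth_arg_ge\<close> at an endpoint: its mirror image keeps the capital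
  at 0 positive even for \<open>\<mu> = 0\<close>, where the minimum degenerates to 0.\<close>

lemma capital_1_ge:
  assumes "c \<ge> 1 / 4" "m \<in> {0..1}" "\<mu> \<in> {0..1}"
  shows "\<mu> \<le> capital c m \<mu> 1"
proof -
  have "0 \<le> (1 - m) * (1 - m) * \<mu>" using assms by simp
  then have "- ((\<mu> - m) * (1 - m)) \<le> (1 - \<mu>) * (m * (1 - m))" by (simp add: algebra_simps)
  also have "\<dots> \<le> (1 - \<mu>) * c"
    using assms mult_one_minus_le_quarter[of m] by (intro mult_left_mono) auto
  finally show ?thesis
    using assms(1) by (simp add: capital_def field_simps)
qed

lemma capital_0_ge:
  assumes "c \<ge> 1 / 4" "m \<in> {0..1}" "\<mu> \<in> {0..1}"
  shows "1 - \<mu> \<le> capital c m \<mu> 0"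
  using capital_1_ge[of c "1 - m" "1 - \<mu>"] capital_reflect[of c m \<mu> 0] assms by simp

lemma capital_pos:
  assumes "c \<ge> 1 / 4" "m \<in> {0..1}" "\<mu> \<in> {0<..<1}" "x \<in> {0..1}"
  shows "0 < capital c m \<mu> x"
  using growth_arg_ge[of c m \<mu> x] assms by (auto simp: capital_def min_def split: if_splits)

lemma bern_inverse_capital_le:
  assumes "c \<ge> 1 / 4" "m \<in> {0..1}" "\<mu> \<in> {0..1}"
  shows "(1 - \<mu>) / capital c m \<mu> 0 + \<mu> / capital c m \<mu> 1 \<le> 1"
proof (cases "\<mu> \<in> {0<..<1}")
  case True
  define a b where "a = capital c m \<mu> 0" and "b = capital c m \<mu> 1"
  have pos: "0 < a" "0 < b" "0 < c"
    using capital_pos[OF assms(1,2) True] assms(1) by (auto simp: a_def b_def)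
  \<comment> \<open>Clearing denominators leaves a square times \<open>c - m * (1 - m)\<close>,
    which is where \<open>c \<ge> 1/4\<close> enters.\<close>
  have "a * b - ((1 - \<mu>) * b + \<mu> * a) = ((\<mu> - m) / c)\<^sup>2 * (c - m * (1 - m))"
    using pos by (simp add: a_def b_def capital_def field_simps power2_eq_square)
  also have "\<dots> \<ge> 0"
    using assms(1) mult_one_minus_le_quarter[of m] by simp
  finally show ?thesis
    using pos by (simp add: field_simps flip: a_def b_def)
next
  case False
  then have "\<mu> = 0 \<or> \<mu> = 1" using assms(3) by auto
  \<comment> \<open>At an extreme mean only the summand at \<open>x = \<mu>\<close> has nonzero
    weight, and there the capital is 1 plus a square over \<open>c\<close>.\<close>
  moreover have "1 \<le> capital c m \<mu> \<mu>" using assms(1) by (simp add: capital_def)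
  ultimately show ?thesis by auto
qed

section \<open>Bernoulli growth as a function of the mean\<close>

lemma bern_growth_reflect: "bern_growth c (1 - m) (1 - \<mu>) = bern_growth c m \<mu>"
  using capital_reflect[of c m \<mu> 0] capital_reflect[of c m \<mu> 1] by (simp add: bern_growth_def)

text \<open>The increment splits into the change of both logarithms under the weights of
  \<open>\<mu>\<^sub>2\<close>, and the gain from moving mass
  \<open>\<mu>\<^sub>2 - \<mu>\<^sub>1\<close> from 0 to 1, nonnegative as
  \<open>a1 \<le> 1 \<le> b1\<close>. Strictness comes from the endpoint 1, where the capital grows
  strictly.\<close>

lemma bern_growth_strict_mono:
  assumes c: "c \<ge> 1 / 4" and m: "m \<in> {0..1}" and "m \<le> \<mu>\<^sub>1" "\<mu>\<^sub>1 < \<mu>\<^sub>2" "\<mu>\<^sub>2 \<le> 1"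
  shows "bern_growth c m \<mu>\<^sub>1 < bern_growth c m \<mu>\<^sub>2"
proof -
  define a1 b1 where "a1 = capital c m \<mu>\<^sub>1 0" and "b1 = capital c m \<mu>\<^sub>1 1"
  define a2 b2 where "a2 = capital c m \<mu>\<^sub>2 0" and "b2 = capital c m \<mu>\<^sub>2 1"
  have c0: "0 < c" using c by simp
  have \<mu>: "\<mu>\<^sub>1 \<in> {0..1}" "\<mu>\<^sub>2 \<in> {0..1}" using assms by auto
  have a: "1 - \<mu>\<^sub>1 \<le> a1" "1 - \<mu>\<^sub>2 \<le> a2"
    using capital_0_ge[OF c m] \<mu> by (auto simp: a1_def a2_def)
  have a1: "0 < a1" using a assms by simp
  have b1: "1 \<le> b1" using assms by (simp add: b1_def capital_def)
  have "(\<mu>\<^sub>1 - m) * (1 - m) < (\<mu>\<^sub>2 - m) * (1 - m)" using assms by simp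
  then have b12: "b1 < b2" using c0 by (simp add: b1_def b2_def capital_def divide_strict_right_mono)
  have "a1 \<le> 1" using assms by (simp add: a1_def capital_def)
  then have "0 \<le> ln b1 - ln a1" using a1 b1 by simp
  then have base: "0 \<le> (\<mu>\<^sub>2 - \<mu>\<^sub>1) * (ln b1 - ln a1)" using assms by simp
  have "1 - b1 / b2 < ln b2 - ln b1"
    using ln_diff_ge[of b1 b2] ln_diff_eqD[of b1 b2] b1 b12 by force
  then have up: "\<mu>\<^sub>2 * (1 - b1 / b2) < \<mu>\<^sub>2 * (ln b2 - ln b1)"
    using assms by simp
  \<comment> \<open>For \<open>\<mu>\<^sub>2 = 1\<close> the capital \<open>a2\<close> may be 0, so
    the vanishing weight has to stay in the inequality.\<close>
  have down: "(1 - \<mu>\<^sub>2) * (1 - a1 / a2) \<le> (1 - \<mu>\<^sub>2) * (ln a2 - ln a1)"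
  proof (cases "\<mu>\<^sub>2 = 1")
    case False
    then show ?thesis using a a1 assms by (intro mult_left_mono ln_diff_ge) auto
  qed simp
  \<comment> \<open>\<open>1 - b1 / b2\<close> and \<open>1 - a1 / a2\<close> are the same multiple \<open>t\<close> of \<open>1 - 1 / b2\<close> and \<open>1 - 1 / a2\<close>.\<close>
  define t where "t = (\<mu>\<^sub>2 - \<mu>\<^sub>1) / (\<mu>\<^sub>2 - m)"
  have t: "0 \<le> t" "t * (\<mu>\<^sub>2 - m) = \<mu>\<^sub>2 - \<mu>\<^sub>1" using assms by (auto simp: t_def)
  have shift: "capital c m \<mu>\<^sub>2 x - capital c m \<mu>\<^sub>1 x = t * (capital c m \<mu>\<^sub>2 x - 1)" for x
  proof -
    have "capital c m \<mu>\<^sub>2 x - capital c m \<mu>\<^sub>1 x = (\<mu>\<^sub>2 - \<mu>\<^sub>1) * (x - m) / c"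
      by (simp add: capital_def diff_divide_distrib left_diff_distrib flip: diff_divide_distrib)
    then show ?thesis unfolding t(2)[symmetric] by (simp add: capital_def)
  qed
  have b_eq: "1 - b1 / b2 = t * (1 - 1 / b2)"
    using shift[of 1] b1 b12 by (simp add: b1_def[symmetric] b2_def[symmetric] field_simps)
  have a_eq: "(1 - \<mu>\<^sub>2) * (1 - a1 / a2) = (1 - \<mu>\<^sub>2) * (t * (1 - 1 / a2))"
  proof (cases "\<mu>\<^sub>2 = 1")
    case False
    then have "0 < a2" using a \<mu> by auto
    then have "1 - a1 / a2 = t * (1 - 1 / a2)"
      using shift[of 0] by (simp add: a1_def[symmetric] a2_def[symmetric] field_simps)
    then show ?thesis by simp
  qed simp
  have "0 \<le> t * (1 - ((1 - \<mu>\<^sub>2) / a2 + \<mu>\<^sub>2 / b2))"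
    using bern_inverse_capital_le[OF c m \<mu>(2)] t(1) by (simp add: a2_def b2_def)
  also have "\<dots> = (1 - \<mu>\<^sub>2) * (1 - a1 / a2) + \<mu>\<^sub>2 * (1 - b1 / b2)"
    unfolding a_eq b_eq by (simp add: algebra_simps)
  finally have "0 < (1 - \<mu>\<^sub>2) * (ln a2 - ln a1) + \<mu>\<^sub>2 * (ln b2 - ln b1)
      + (\<mu>\<^sub>2 - \<mu>\<^sub>1) * (ln b1 - ln a1)"
    using up down base by linarith
  also have "\<dots> = bern_growth c m \<mu>\<^sub>2 - bern_growth c m \<mu>\<^sub>1"
    unfolding bern_growth_def a1_def[symmetric] a2_def[symmetric] b1_def[symmetric] b2_def[symmetric]
    by (simp only: algebra_simps)
  finally show ?thesis by simp
qed

lemma bern_growth_less: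
  assumes "c \<ge> 1 / 4" "m \<in> {0..1}" "\<mu>\<^sub>1 \<in> {0..1}" "\<mu>\<^sub>2 \<in> {0..1}"
    and "\<mu>\<^sub>1 \<le> m \<and> \<mu>\<^sub>2 \<le> m \<or> \<mu>\<^sub>1 \<ge> m \<and> \<mu>\<^sub>2 \<ge> m" "\<bar>\<mu>\<^sub>1 - m\<bar> < \<bar>\<mu>\<^sub>2 - m\<bar>"
  shows "bern_growth c m \<mu>\<^sub>1 < bern_growth c m \<mu>\<^sub>2"
  using assms(5)
proof
  assume "\<mu>\<^sub>1 \<le> m \<and> \<mu>\<^sub>2 \<le> m"
  then have "bern_growth c (1 - m) (1 - \<mu>\<^sub>1) < bern_growth c (1 - m) (1 - \<mu>\<^sub>2)"
    using assms by (intro bern_growth_strict_mono) auto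
  then show ?thesis by (simp add: bern_growth_reflect)
next
  assume "\<mu>\<^sub>1 \<ge> m \<and> \<mu>\<^sub>2 \<ge> m"
  then show ?thesis using assms by (intro bern_growth_strict_mono) auto
qed

section \<open>Affine integrands and distributions on two points\<close>

lemma dists_with_meanD:
  assumes "P \<in> dists_with_mean \<mu>"
  shows "real_distribution P" "AE x in P. x \<in> {0..1}" "mean P = \<mu>" "(LINT x|P. x) = \<mu>"
  using assms by (auto simp: dists_with_mean_def mean_def)

text \<open>Only the mean enters, so a chord over [0, 1] has the same expectation under every member
  of \<open>dists_with_mean \<mu>\<close>.\<close>

lemma integral_affine:
  assumes "P \<in> dists_with_mean \<mu>"
  shows "integrable P (\<lambda>x. (1 - x) * a + x * b)"
    and "(LINT x|P. (1 - x) * a + x * b) = (1 - \<mu>) * a + \<mu> * b"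
proof -
  interpret real_distribution P by (rule dists_with_meanD[OF assms])
  note int = dists_with_mean_integrable[OF assms]
  show "integrable P (\<lambda>x. (1 - x) * a + x * b)"
    using int by simp
  show "(LINT x|P. (1 - x) * a + x * b) = (1 - \<mu>) * a + \<mu> * b"
    using int dists_with_meanD(4)[OF assms] prob_space by simp
qed

text \<open>On {0, 1} every function coincides with its chord.\<close>

lemma integral_two_point:
  assumes P: "P \<in> dists_with_mean \<mu>" and AE: "AE x in P. x \<in> {0, 1}"
    and f: "f \<in> borel_measurable borel"
  shows "(LINT x|P. f x) = (1 - \<mu>) * f 0 + \<mu> * f 1"
proof -
  interpret real_distribution P by (rule dists_with_meanD[OF P])
  have "(LINT x|P. f x) = (LINT x|P. (1 - x) * f 0 + x * f 1)"
  proof (rule integral_cong_AE)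
    show "AE x in P. f x = (1 - x) * f 0 + x * f 1"
      using AE by eventually_elim auto
  qed (use f in simp_all)
  then show ?thesis using integral_affine(2)[OF P] by simp
qed

lemma AE_bern: "AE x in bern \<mu>. x \<in> {0, 1}"
  unfolding bern_def by (subst AE_distr_iff) (auto simp: of_bool_def)

text \<open>The integral of an indicator is determined by \<open>\<mu>\<close> on both sides, so the
  measures agree on every Borel set.\<close>

lemma two_point_eq_bern:
  assumes P: "P \<in> dists_with_mean \<mu>" and AE: "AE x in P. x \<in> {0, 1}" and \<mu>: "\<mu> \<in> {0..1}"
  shows "P = bern \<mu>"
proof -
  have B: "bern \<mu> \<in> dists_with_mean \<mu>" using \<mu> by (intro bern_in_dists_with_mean) auto
  interpret P: real_distribution P by (rule dists_with_meanD[OF P])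
  interpret B: real_distribution "bern \<mu>" by (rule dists_with_meanD[OF B])
  show ?thesis
  proof (rule measure_eqI)
    show "sets P = sets (bern \<mu>)" by simp
    fix A assume "A \<in> sets P"
    then have A: "A \<in> sets borel" by simp
    then have ind: "(indicator A :: real \<Rightarrow> real) \<in> borel_measurable borel" by simp
    have "measure P A = measure (bern \<mu>) A"
      using integral_two_point[OF P AE ind] integral_two_point[OF B AE_bern ind] A by simp
    then show "emeasure P A = emeasure (bern \<mu>) A"
      by (simp add: P.emeasure_eq_measure B.emeasure_eq_measure)
  qed
qed

section \<open>Expected log capital and minimality of the Bernoulli distribution\<close>

lemma growth_eq:
  assumes "P \<in> dists_with_mean \<mu>"
  shows "growth c m P = (LINT x|P. ln (capital c m \<mu> x))"
  using dists_with_meanD(3)[OF assms] by (simp add: growth_def capital_def)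

lemma integrable_ln_capital:
  assumes "c \<ge> 1 / 4" "m \<in> {0..1}" "\<mu> \<in> {0..1}" "P \<in> dists_with_mean \<mu>"
  shows "integrable P (\<lambda>x. ln (capital c m \<mu> x))"
  using growth_integrable[OF assms] dists_with_meanD(3)[OF assms(4)] by (simp add: capital_def)

lemma growth_two_point:
  assumes "P \<in> dists_with_mean \<mu>" "AE x in P. x \<in> {0, 1}"
  shows "growth c m P = bern_growth c m \<mu>"
proof -
  have "(\<lambda>x. ln (capital c m \<mu> x)) \<in> borel_measurable borel"
    unfolding capital_def by measurable
  then show ?thesis
    using integral_two_point[OF assms] by (simp add: growth_eq[OF assms(1)] bern_growth_def)
qed

text \<open>An extreme mean forces a point mass, which brings the means excluded by
  \<open>capital_pos\<close> under the two-point formulas.\<close>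

lemma dists_with_mean_two_point:
  assumes "P \<in> dists_with_mean \<mu>" "\<mu> = 0 \<or> \<mu> = 1"
  shows "AE x in P. x \<in> {0, 1}"
  using dists_with_mean_degenerate[OF assms] assms(2) by auto

lemma growth_bern:
  assumes "\<mu> \<in> {0..1}"
  shows "growth c m (bern \<mu>) = bern_growth c m \<mu>"
  using assms bern_in_dists_with_mean by (intro growth_two_point AE_bern) auto

text \<open>The expectation of the nonnegative \<open>?gap\<close> is the excess over the Bernoulli
  value. If it is 0, the gap vanishes almost surely, which strict concavity allows only at the
  endpoints.\<close>

lemma bern_growth_le_growth:
  assumes c: "c \<ge> 1 / 4" and m: "m \<in> {0..1}" and \<mu>: "\<mu> \<in> {0..1}" and P: "P \<in> dists_with_mean \<mu>"
  shows "bern_growth c m \<mu> \<le> growth c m P"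
    and "\<mu> \<noteq> m \<Longrightarrow> growth c m P = bern_growth c m \<mu> \<Longrightarrow> AE x in P. x \<in> {0, 1}"
proof -
  define a b where "a = ln (capital c m \<mu> 0)" and "b = ln (capital c m \<mu> 1)"
  let ?gap = "\<lambda>x. ln (capital c m \<mu> x) - ((1 - x) * a + x * b)"
  have int: "integrable P ?gap"
    by (intro Bochner_Integration.integrable_diff integrable_ln_capital[OF c m \<mu> P]
        integral_affine(1)[OF P])
  have val: "(LINT x|P. ?gap x) = growth c m P - bern_growth c m \<mu>"
    by (subst Bochner_Integration.integral_diff)
      (auto simp: growth_eq[OF P] integral_affine[OF P] bern_growth_def a_def b_def
        intro: integrable_ln_capital[OF c m \<mu> P])
  have gap: "0 \<le> ?gap x" "\<mu> \<noteq> m \<Longrightarrow> ?gap x = 0 \<Longrightarrow> x \<in> {0, 1}"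
    if inner: "\<mu> \<in> {0<..<1}" and x: "x \<in> {0..1}" for x
  proof -
    have pos: "0 < capital c m \<mu> 0" "0 < capital c m \<mu> 1"
      using capital_pos[OF c m inner] by auto
    show "0 \<le> ?gap x"
      using ln_chord_le(1)[OF pos, of x] x capital_chord[of c m \<mu> x] by (simp add: a_def b_def)
    assume "\<mu> \<noteq> m" "?gap x = 0"
    \<comment> \<open>Strict concavity along the chord needs distinct end values, that is, a nonzero
      slope in \<open>x\<close>.\<close>
    moreover have "capital c m \<mu> 1 - capital c m \<mu> 0 = (\<mu> - m) / c"
      by (simp add: capital_def algebra_simps diff_divide_distrib add_divide_distrib)
    then have "capital c m \<mu> 0 \<noteq> capital c m \<mu> 1"
      using \<open>\<mu> \<noteq> m\<close> c by auto
    ultimately show "x \<in> {0, 1}"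
      using ln_chord_le(2)[OF pos, of x] x capital_chord[of c m \<mu> x]
      by (auto simp: a_def b_def)
  qed
  show "bern_growth c m \<mu> \<le> growth c m P"
  proof (cases "\<mu> \<in> {0<..<1}")
    case True
    have "AE x in P. 0 \<le> ?gap x"
      using dists_with_meanD(2)[OF P] by eventually_elim (rule gap(1)[OF True])
    then show ?thesis using integral_nonneg_AE[of ?gap P] val by simp
  next
    case False
    then show ?thesis using growth_two_point[OF P dists_with_mean_two_point[OF P]] \<mu> by auto
  qed
  assume ne: "\<mu> \<noteq> m" and eq: "growth c m P = bern_growth c m \<mu>"
  show "AE x in P. x \<in> {0, 1}"
  proof (cases "\<mu> \<in> {0<..<1}")
    case True
    have "AE x in P. 0 \<le> ?gap x"
      using dists_with_meanD(2)[OF P] by eventually_elim (rule gap(1)[OF True])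
    then have "AE x in P. ?gap x = 0"
      using integral_nonneg_eq_0_iff_AE[OF int] val eq by simp
    with dists_with_meanD(2)[OF P] show ?thesis
      by eventually_elim (rule gap(2)[OF True _ ne])
  next
    case False
    then show ?thesis using dists_with_mean_two_point[OF P] \<mu> by auto
  qed
qed

lemma worst_growth_eq:
  assumes "c \<ge> 1 / 4" "m \<in> {0..1}" "\<mu> \<in> {0..1}"
  shows "worst_growth c m \<mu> = ereal (bern_growth c m \<mu>)"
  unfolding worst_growth_def
proof (rule antisym)
  show "(INF P\<in>dists_with_mean \<mu>. ereal (growth c m P)) \<le> ereal (bern_growth c m \<mu>)"
    using assms bern_in_dists_with_mean growth_bern
    by (intro INF_lower2[of "bern \<mu>"]) auto
  show "ereal (bern_growth c m \<mu>) \<le> (INF P\<in>dists_with_mean \<mu>. ereal (growth c m P))"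
    using bern_growth_le_growth(1)[OF assms] by (intro INF_greatest) auto
qed

section \<open>Dependence on \<open>m\<close> for a fixed distribution\<close>

text \<open>With \<open>u\<close>, \<open>v\<close> the capitals for \<open>m\<^sub>1\<close>,
  \<open>m\<^sub>2\<close>, pointwise
  \<open>ln v - ln u \<ge> 1 - u / v \<ge> t * (1 - 1 / v) \<ge> ?l x\<close>. The last bound is
  affine, so its expectation is the Bernoulli one, nonnegative by
  \<open>bern_inverse_capital_le\<close>.\<close>

lemma growth_strict_mono_inner:
  assumes c: "c \<ge> 1 / 4" and \<mu>: "\<mu> \<in> {0<..<1}" and P: "P \<in> dists_with_mean \<mu>"
    and m: "m\<^sub>1 \<in> {0..1}" "m\<^sub>2 \<in> {0..1}"
    and side: "m\<^sub>1 \<le> \<mu> \<and> m\<^sub>2 \<le> \<mu> \<or> m\<^sub>1 \<ge> \<mu> \<and> m\<^sub>2 \<ge> \<mu>"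
    and less: "\<bar>\<mu> - m\<^sub>1\<bar> < \<bar>\<mu> - m\<^sub>2\<bar>"
  shows "growth c m\<^sub>1 P < growth c m\<^sub>2 P"
proof -
  interpret real_distribution P by (rule dists_with_meanD[OF P])
  have c0: "0 < c" using c by simp
  have \<mu>': "\<mu> \<in> {0..1}" using \<mu> by auto
  define a b where "a = capital c m\<^sub>2 \<mu> 0" and "b = capital c m\<^sub>2 \<mu> 1"
  \<comment> \<open>The position of \<open>m\<^sub>1\<close> on the way from
    \<open>m\<^sub>2\<close> to \<open>\<mu>\<close>.\<close>
  define t where "t = (m\<^sub>1 - m\<^sub>2) / (\<mu> - m\<^sub>2)"
  have ne: "\<mu> \<noteq> m\<^sub>2" using less by auto
  have t: "0 \<le> t" "t * (\<mu> - m\<^sub>2) = m\<^sub>1 - m\<^sub>2"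
    using side less ne by (auto simp: t_def divide_nonpos_neg)
  have pos: "0 < a" "0 < b" using capital_pos[OF c m(2) \<mu>] by (auto simp: a_def b_def)
  let ?l = "\<lambda>x. (1 - x) * (t * (1 - 1 / a)) + x * (t * (1 - 1 / b))"
  let ?g = "\<lambda>x. ln (capital c m\<^sub>2 \<mu> x) - ln (capital c m\<^sub>1 \<mu> x)"
  have bounds: "?l x \<le> ?g x" "?g x = ?l x \<Longrightarrow> x = m\<^sub>1 + m\<^sub>2 - \<mu>"
    if x: "x \<in> {0..1}" for x
  proof -
    define u v where "u = capital c m\<^sub>1 \<mu> x" and "v = capital c m\<^sub>2 \<mu> x"
    have uv: "0 < u" "0 < v"
      using capital_pos[OF c _ \<mu> x] m by (auto simp: u_def v_def)
    have diff: "v - u = (m\<^sub>1 - m\<^sub>2) * (x + \<mu> - m\<^sub>1 - m\<^sub>2) / c"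
      using c0 by (simp add: u_def v_def capital_def field_simps)
    have vt: "t * (v - 1) = (m\<^sub>1 - m\<^sub>2) * (x - m\<^sub>2) / c"
      unfolding t(2)[symmetric] by (simp add: v_def capital_def)
    \<comment> \<open>By the choice of \<open>t\<close>, the difference of \<open>v - u\<close> and
      \<open>t * (v - 1)\<close> does not depend on \<open>x\<close>; it is nonnegative because
      \<open>m\<^sub>1\<close> lies between \<open>\<mu>\<close> and
      \<open>m\<^sub>2\<close>.\<close>
    have "0 \<le> (m\<^sub>1 - m\<^sub>2) * (\<mu> - m\<^sub>1) / c"
      using side less c0 by (auto intro!: divide_nonneg_pos simp: zero_le_mult_iff)
    also have "\<dots> = (v - u) - t * (v - 1)"
      unfolding diff vt by (simp add: algebra_simps flip: diff_divide_distrib)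
    finally have "t * (v - 1) / v \<le> (v - u) / v"
      using uv by (intro divide_right_mono) auto
    then have "t * (1 - 1 / v) \<le> 1 - u / v"
      using uv by (simp add: diff_divide_distrib right_diff_distrib)
    moreover have "?l x \<le> t * (1 - 1 / v)"
    proof -
      have "t * (1 / v) \<le> t * ((1 - x) / a + x / b)"
        using inverse_chord_ge[OF pos, of x] x capital_chord[of c m\<^sub>2 \<mu> x] t(1)
        by (intro mult_left_mono) (auto simp: a_def b_def v_def)
      then show ?thesis by (simp add: algebra_simps)
    qed
    ultimately have l: "?l x \<le> 1 - u / v" by linarith
    show "?l x \<le> ?g x"
      using l ln_diff_ge[OF uv] by (simp add: u_def v_def)
    assume "?g x = ?l x"
    then have "ln v - ln u = 1 - u / v"
      using l ln_diff_ge[OF uv] by (simp add: u_def v_def)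
    then have "v - u = 0" using ln_diff_eqD[OF uv] by simp
    then show "x = m\<^sub>1 + m\<^sub>2 - \<mu>"
      using diff c0 less by auto
  qed
  have int_g: "integrable P ?g"
    using integrable_ln_capital[OF c _ \<mu>' P] m by simp
  have int_l: "integrable P ?l" by (rule integral_affine(1)[OF P])
  have int: "integrable P (\<lambda>x. ?g x - ?l x)"
    using int_g int_l by (rule Bochner_Integration.integrable_diff)
  have "(LINT x|P. ?l x) = t * (1 - ((1 - \<mu>) / a + \<mu> / b))"
    unfolding integral_affine(2)[OF P] by (simp add: algebra_simps)
  also have "\<dots> \<ge> 0"
    using bern_inverse_capital_le[OF c m(2) \<mu>'] t(1) by (simp add: a_def b_def)
  finally have l_nonneg: "0 \<le> (LINT x|P. ?l x)" .
  have g_val: "(LINT x|P. ?g x) = growth c m\<^sub>2 P - growth c m\<^sub>1 P"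
    using integrable_ln_capital[OF c _ \<mu>' P] m by (simp add: growth_eq[OF P])
  have val: "(LINT x|P. ?g x - ?l x) = growth c m\<^sub>2 P - growth c m\<^sub>1 P - (LINT x|P. ?l x)"
    using Bochner_Integration.integral_diff[OF int_g int_l] g_val by simp
  have nonneg: "AE x in P. 0 \<le> ?g x - ?l x"
    using dists_with_meanD(2)[OF P]
  proof eventually_elim
    case (elim x)
    then show ?case using bounds(1)[of x] by linarith
  qed
  \<comment> \<open>Otherwise \<open>P\<close> would be a point mass at
    \<open>m\<^sub>1 + m\<^sub>2 - \<mu>\<close>. Its mean being \<open>\<mu>\<close>, the points
    \<open>m\<^sub>1\<close> and \<open>m\<^sub>2\<close> would be equally far from
    \<open>\<mu>\<close>.\<close>
  have "(LINT x|P. ?g x - ?l x) \<noteq> 0"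
  proof
    assume "(LINT x|P. ?g x - ?l x) = 0"
    then have "AE x in P. ?g x - ?l x = 0"
      using integral_nonneg_eq_0_iff_AE[OF int nonneg] by blast
    with dists_with_meanD(2)[OF P] have "AE x in P. x = m\<^sub>1 + m\<^sub>2 - \<mu>"
    proof eventually_elim
      case (elim x)
      then show ?case using bounds(2)[of x] by linarith
    qed
    then have "(LINT x|P. x) = (LINT x|P. m\<^sub>1 + m\<^sub>2 - \<mu>)"
      by (intro integral_cong_AE) auto
    then have "\<mu> = m\<^sub>1 + m\<^sub>2 - \<mu>"
      using dists_with_meanD(4)[OF P] prob_space by simp
    then show False using side less by auto
  qed
  moreover have "0 \<le> (LINT x|P. ?g x - ?l x)"
    using nonneg by (rule integral_nonneg_AE)
  ultimately show ?thesis using val l_nonneg by linarith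
qed

lemma growth_strict_mono:
  assumes c: "c \<ge> 1 / 4" and \<mu>: "\<mu> \<in> {0..1}" and P: "P \<in> dists_with_mean \<mu>"
    and "m\<^sub>1 \<in> {0..1}" "m\<^sub>2 \<in> {0..1}"
    and "m\<^sub>1 \<le> \<mu> \<and> m\<^sub>2 \<le> \<mu> \<or> m\<^sub>1 \<ge> \<mu> \<and> m\<^sub>2 \<ge> \<mu>"
    and less: "\<bar>\<mu> - m\<^sub>1\<bar> < \<bar>\<mu> - m\<^sub>2\<bar>"
  shows "growth c m\<^sub>1 P < growth c m\<^sub>2 P"
proof (cases "\<mu> \<in> {0<..<1}")
  case True
  then show ?thesis using growth_strict_mono_inner assms by blast
next
  case False
  then have deg: "\<mu> = 0 \<or> \<mu> = 1" using \<mu> by auto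
  \<comment> \<open>Here \<open>P\<close> is the point mass at \<open>\<mu>\<close>, and the growth
    rate is an explicit increasing function of \<open>(\<mu> - m)\<^sup>2\<close>.\<close>
  then have "growth c m P = ln (capital c m \<mu> \<mu>)" for m
    using growth_two_point[OF P dists_with_mean_two_point[OF P deg], of c m]
    by (auto simp: bern_growth_def)
  moreover have "(\<mu> - m\<^sub>1)\<^sup>2 < (\<mu> - m\<^sub>2)\<^sup>2"
    using less by (metis abs_ge_zero power2_abs power_strict_mono zero_less_numeral)
  then have "capital c m\<^sub>1 \<mu> \<mu> < capital c m\<^sub>2 \<mu> \<mu>"
    using c by (simp add: capital_def power2_eq_square divide_strict_right_mono)
  moreover have "1 \<le> capital c m\<^sub>1 \<mu> \<mu>" using c by (simp add: capital_def)
  ultimately show ?thesis by simp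
qed

section \<open>Sign of the growth rate and the combined result\<close>

lemma growth_mean_eq_0:
  assumes "P \<in> dists_with_mean \<mu>"
  shows "growth c \<mu> P = 0"
  by (simp add: growth_eq[OF assms] capital_def)

lemma growth_pos:
  assumes "c \<ge> 1 / 4" "m \<in> {0..1}" "\<mu> \<in> {0..1}" "P \<in> dists_with_mean \<mu>" "\<mu> \<noteq> m"
  shows "0 < growth c m P"
  using growth_strict_mono[of c \<mu> P \<mu> m] growth_mean_eq_0 assms by force

lemma worst_growth_nonneg:
  assumes "c \<ge> 1 / 4" "m \<in> {0..1}" "\<mu> \<in> {0..1}"
  shows "0 \<le> worst_growth c m \<mu>"
  unfolding worst_growth_def
proof (rule INF_greatest)
  fix P assume "P \<in> dists_with_mean \<mu>"
  then show "0 \<le> ereal (growth c m P)"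
    using growth_pos[OF assms] growth_mean_eq_0 by (cases "\<mu> = m") (auto simp: less_imp_le)
qed

text \<open>Uniqueness of the minimiser is claimed for \<open>\<mu> \<noteq> m\<close>, since for
  \<open>\<mu> = m\<close> every growth rate is 0. Monotonicity is read both ways, moving
  \<open>m\<close> under a fixed \<open>P\<close> and moving the mean in the worst case, each time
  on one side, because the growth rate is not a function of the distance alone.\<close>

theorem lemma2:
  fixes c :: real
  assumes c: "c \<ge> 1 / 4"
  shows
    "(\<forall>m\<in>{0..1}. \<forall>\<mu>\<in>{0..1}.
          bern \<mu> \<in> dists_with_mean \<mu>
        \<and> ereal (growth c m (bern \<mu>)) = worst_growth c m \<mu>
        \<and> (\<mu> \<noteq> m \<longrightarrow> (\<forall>P\<in>dists_with_mean \<mu>.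
              ereal (growth c m P) = worst_growth c m \<mu> \<longrightarrow> P = bern \<mu>)))
   \<and> (\<forall>m\<in>{0..1}. \<forall>\<mu>\<in>{0..1}. worst_growth c m \<mu> \<ge> 0)
   \<and> (\<forall>m\<in>{0..1}. \<forall>\<mu>\<in>{0..1}. \<forall>P\<in>dists_with_mean \<mu>. growth c m P = 0 \<longrightarrow> \<mu> = m)
   \<and> (\<forall>\<mu>\<in>{0..1}. \<forall>P\<in>dists_with_mean \<mu>. \<forall>m\<^sub>1\<in>{0..1}. \<forall>m\<^sub>2\<in>{0..1}.
        (m\<^sub>1 \<le> \<mu> \<and> m\<^sub>2 \<le> \<mu> \<or> m\<^sub>1 \<ge> \<mu> \<and> m\<^sub>2 \<ge> \<mu>) \<and> \<bar>\<mu> - m\<^sub>1\<bar> < \<bar>\<mu> - m\<^sub>2\<bar>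
        \<longrightarrow> growth c m\<^sub>1 P < growth c m\<^sub>2 P)
   \<and> (\<forall>m\<in>{0..1}. \<forall>\<mu>\<^sub>1\<in>{0..1}. \<forall>\<mu>\<^sub>2\<in>{0..1}.
        (\<mu>\<^sub>1 \<le> m \<and> \<mu>\<^sub>2 \<le> m \<or> \<mu>\<^sub>1 \<ge> m \<and> \<mu>\<^sub>2 \<ge> m) \<and> \<bar>\<mu>\<^sub>1 - m\<bar> < \<bar>\<mu>\<^sub>2 - m\<bar>
        \<longrightarrow> worst_growth c m \<mu>\<^sub>1 < worst_growth c m \<mu>\<^sub>2)"
proof (intro conjI ballI impI; (elim conjE)?)
  fix m \<mu> :: real assume m: "m \<in> {0..1}" and \<mu>: "\<mu> \<in> {0..1}"
  show "bern \<mu> \<in> dists_with_mean \<mu>"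
    using \<mu> by (intro bern_in_dists_with_mean) auto
  show "ereal (growth c m (bern \<mu>)) = worst_growth c m \<mu>"
    by (simp add: growth_bern[OF \<mu>] worst_growth_eq[OF c m \<mu>])
  show "0 \<le> worst_growth c m \<mu>"
    by (rule worst_growth_nonneg[OF c m \<mu>])
  fix P assume P: "P \<in> dists_with_mean \<mu>"
  show "P = bern \<mu>" if "\<mu> \<noteq> m" "ereal (growth c m P) = worst_growth c m \<mu>"
    using bern_growth_le_growth(2)[OF c m \<mu> P] that
    by (intro two_point_eq_bern[OF P _ \<mu>]) (simp add: worst_growth_eq[OF c m \<mu>])
  show "\<mu> = m" if "growth c m P = 0"
    using growth_pos[OF c m \<mu> P] that by force
next
  fix \<mu> P m\<^sub>1 m\<^sub>2
  assume "\<mu> \<in> {0..1}" "P \<in> dists_with_mean \<mu>" "m\<^sub>1 \<in> {0..1}" "m\<^sub>2 \<in> {0..1}"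
    "m\<^sub>1 \<le> \<mu> \<and> m\<^sub>2 \<le> \<mu> \<or> m\<^sub>1 \<ge> \<mu> \<and> m\<^sub>2 \<ge> \<mu>" "\<bar>\<mu> - m\<^sub>1\<bar> < \<bar>\<mu> - m\<^sub>2\<bar>"
  then show "growth c m\<^sub>1 P < growth c m\<^sub>2 P" by (rule growth_strict_mono[OF c])
next
  fix m \<mu>\<^sub>1 \<mu>\<^sub>2 :: real
  assume "m \<in> {0..1}" "\<mu>\<^sub>1 \<in> {0..1}" "\<mu>\<^sub>2 \<in> {0..1}"
    "\<mu>\<^sub>1 \<le> m \<and> \<mu>\<^sub>2 \<le> m \<or> \<mu>\<^sub>1 \<ge> m \<and> \<mu>\<^sub>2 \<ge> m" "\<bar>\<mu>\<^sub>1 - m\<bar> < \<bar>\<mu>\<^sub>2 - m\<bar>"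
  then show "worst_growth c m \<mu>\<^sub>1 < worst_growth c m \<mu>\<^sub>2"
    using bern_growth_less[OF c] worst_growth_eq[OF c] by simp
qed

end
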